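(* Let $\mathsf R>0$ and $\widehat\beta\ge0$. There exist constants $A<0$, $B<0$ and $c_0=c_0(\mathsf R,\widehat\beta)>0$ such that every (sufficiently regular) solution $(\theta,\mathbf u,\Pi)$, $\mathbf u=(u,w)$, of $$\Delta \Pi-\widehat\beta\,\Pi_z=\mathsf R\, e^{\widehat\beta z}\theta_z,\qquad \mathbf u=-e^{-\widehat\beta z}\nabla\Pi+\mathsf R\,\theta\,\mathbf k,\qquad \theta_t+\mathbf u\cdot\nabla\theta=w+\Delta\theta$$ with $w=\theta=\Pi_z=0$ on $z=0,1$, $1$-periodic in $x$ and with $\Pi$ of zero mean, satisfies the a priori estimate $$\frac{\mathsf R}{2}\frac{d}{dt}\|\theta\|_{L^2}^2+\mathsf R\|\nabla\theta\|_{L^2}^2-A\|\mathbf u\|_{L^2}^2-B\|\nabla\Pi\|_{L^2}^2\le c_0(\mathsf R,\widehat\beta)\,\|\theta\|_{L^2}^2,$$ and in particular, with $E(t):=\frac{\mathsf R}{2}\|\theta(t)\|_{L^2}^2$, $$E(t)\le E(0)\,e^{c_0t}.$$ Moreover, if $\mathsf R$ is sufficiently small, then $E(t)$ decays exponentially in time.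
   Context: All $L^2$ norms are over the periodicity cell $\Omega_0=[0,1]\times[0,1]$ with points $(x,z)$; $\mathbf k=(0,1)$ is the vertical unit vector; subscripts $z,t$ denote partial derivatives. $\mathsf R$ is the Darcy-Rayleigh number and $\widehat\beta$ the dimensionless compressibility factor. "Sufficiently small" is relative to $\widehat\beta$: there is a threshold $\mathsf R_0(\widehat\beta)>0$ below which $E$ decays exponentially. *)

theory Defs
  imports "HOL-Analysis.Analysis"
begin

text \<open>
  A point of the layer is a pair \<open>(x, z)\<close>. Functions that are \<open>1\<close>-periodic in \<open>x\<close> are functions on
  the whole strip, and integrals are taken over the periodicity cell.
\<close>

definition strip :: "(real \<times> real) set"
  where "strip = UNIV \<times> {0..1}"

definition cell :: "(real \<times> real) set"
  where "cell = {0..1} \<times> {0..1}"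

definition l2norm :: "(real \<times> real \<Rightarrow> 'a::real_normed_vector) \<Rightarrow> real"
  where "l2norm f = sqrt (integral cell (\<lambda>p. (norm (f p))\<^sup>2))"

definition dx :: "(real \<times> real \<Rightarrow> real) \<Rightarrow> real \<times> real \<Rightarrow> real"
  where "dx f p = deriv (\<lambda>s. f (s, snd p)) (fst p)"

text \<open>The derivative in \<open>z\<close> is one-sided on the boundary lines \<open>z = 0\<close> and \<open>z = 1\<close>.\<close>

definition dz :: "(real \<times> real \<Rightarrow> real) \<Rightarrow> real \<times> real \<Rightarrow> real"
  where "dz f p = vector_derivative (\<lambda>s. f (fst p, s)) (at (snd p) within {0..1})"

definition grad :: "(real \<times> real \<Rightarrow> real) \<Rightarrow> real \<times> real \<Rightarrow> real \<times> real"
  where "grad f p = (dx f p, dz f p)"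

definition laplacian :: "(real \<times> real \<Rightarrow> real) \<Rightarrow> real \<times> real \<Rightarrow> real"
  where "laplacian f p = dx (dx f) p + dz (dz f) p"

text \<open>Regularity is understood up to the boundary of the strip.\<close>

definition C1_strip :: "(real \<times> real \<Rightarrow> real) \<Rightarrow> bool"
  where "C1_strip f \<longleftrightarrow>
    continuous_on strip f \<and>
    (\<forall>(x, z)\<in>strip. (\<lambda>s. f (s, z)) differentiable at x \<and>
                    (\<lambda>s. f (x, s)) differentiable (at z within {0..1})) \<and>
    continuous_on strip (dx f) \<and> continuous_on strip (dz f)"

definition C2_strip :: "(real \<times> real \<Rightarrow> real) \<Rightarrow> bool"
  where "C2_strip f \<longleftrightarrow> C1_strip f \<and> C1_strip (dx f) \<and> C1_strip (dz f)"

definition x_periodic :: "(real \<times> real \<Rightarrow> 'a) \<Rightarrow> bool"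
  where "x_periodic f \<longleftrightarrow> (\<forall>(x, z)\<in>strip. f (x + 1, z) = f (x, z))"

text \<open>
  Classical solutions on the time interval \<open>[0, T)\<close>, where \<open>T\<close> may be infinite. The temperature is
  continuous up to the initial time; everything else is only required at positive times. The
  equations are imposed on the closed strip: by continuity this is the same as
  imposing them in its interior.
\<close>

definition is_solution ::
  "real \<Rightarrow> real \<Rightarrow> ereal \<Rightarrow> (real \<Rightarrow> real \<times> real \<Rightarrow> real) \<Rightarrow>
   (real \<Rightarrow> real \<times> real \<Rightarrow> real \<times> real) \<Rightarrow> (real \<Rightarrow> real \<times> real \<Rightarrow> real) \<Rightarrow> bool"
  where "is_solution R \<beta> T \<theta> u P \<longleftrightarrow>
    continuous_on ({t. 0 \<le> t \<and> ereal t < T} \<times> strip) (\<lambda>(t, p). \<theta> t p) \<and>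
    (\<forall>t p. 0 < t \<longrightarrow> ereal t < T \<longrightarrow> p \<in> strip \<longrightarrow> (\<lambda>s. \<theta> s p) differentiable at t) \<and>
    continuous_on ({t. 0 < t \<and> ereal t < T} \<times> strip) (\<lambda>(t, p). deriv (\<lambda>s. \<theta> s p) t) \<and>
    (\<forall>t. 0 < t \<longrightarrow> ereal t < T \<longrightarrow> C2_strip (\<theta> t) \<and> C2_strip (P t)) \<and>
    (\<forall>t. 0 \<le> t \<longrightarrow> ereal t < T \<longrightarrow> x_periodic (\<theta> t)) \<and>
    (\<forall>t. 0 < t \<longrightarrow> ereal t < T \<longrightarrow>
        x_periodic (u t) \<and> x_periodic (P t) \<and> integral cell (P t) = 0) \<and>
    (\<forall>t x z. 0 < t \<longrightarrow> ereal t < T \<longrightarrow> z \<in> {0, 1} \<longrightarrow>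
        snd (u t (x, z)) = 0 \<and> \<theta> t (x, z) = 0 \<and> dz (P t) (x, z) = 0) \<and>
    (\<forall>t x z. 0 < t \<longrightarrow> ereal t < T \<longrightarrow> (x, z) \<in> strip \<longrightarrow>
        laplacian (P t) (x, z) - \<beta> * dz (P t) (x, z) = R * exp (\<beta> * z) * dz (\<theta> t) (x, z) \<and>
        u t (x, z) = - exp (- \<beta> * z) *\<^sub>R grad (P t) (x, z) + (R * \<theta> t (x, z)) *\<^sub>R (0, 1) \<and>
        deriv (\<lambda>s. \<theta> s (x, z)) t + u t (x, z) \<bullet> grad (\<theta> t) (x, z)
          = snd (u t (x, z)) + laplacian (\<theta> t) (x, z))"

definition energy :: "real \<Rightarrow> (real \<Rightarrow> real \<times> real \<Rightarrow> real) \<Rightarrow> real \<Rightarrow> real"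
  where "energy R \<theta> t = R / 2 * (l2norm (\<theta> t))\<^sup>2"

end

theory Submission
  imports Defs
begin

text \<open>
  The two constitutive equations make the velocity solenoidal: since
  \<open>div (e\<^sup>-\<^sup>\<beta>\<^sup>z \<nabla>P) = e\<^sup>-\<^sup>\<beta>\<^sup>z (\<Delta>P - \<beta> P\<^sub>z) = R \<theta>\<^sub>z\<close>, taking the divergence of
  \<open>u = - e\<^sup>-\<^sup>\<beta>\<^sup>z \<nabla>P + R \<theta> k\<close> gives \<open>0\<close>. Hence testing the heat equation with \<open>\<theta>\<close> kills the
  convective term and leaves \<open>\<integral> \<theta> \<theta>\<^sub>t = \<integral> \<theta> w - \<integral> |\<nabla>\<theta>|\<^sup>2\<close> (\<open>energy_balance\<close>), where
  \<open>w\<close> is the vertical velocity. Only the buoyancy term \<open>\<integral> \<theta> w\<close> can feed the energy.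

  Testing the pressure equation with \<open>P\<close> gives \<open>\<integral> e\<^sup>-\<^sup>\<beta>\<^sup>z |\<nabla>P|\<^sup>2 = R \<integral> \<theta> P\<^sub>z\<close>. The weight is at
  least \<open>e\<^sup>-\<^sup>\<beta>\<close> on the layer, so Young's inequality bounds \<open>\<nabla>P\<close>, and through Darcy's law also
  \<open>u\<close>, in \<open>L\<^sup>2\<close> by \<open>\<theta>\<close> (\<open>pressure_bound\<close>, \<open>velocity_bound\<close>). The velocity bound carries a
  factor \<open>R\<^sup>2\<close>. Estimating \<open>\<integral> \<theta> w\<close> with it gives the a priori estimate with \<open>A = B = -1\<close>, and
  Gronwall's inequality gives exponential growth at most. If \<open>R < e\<^sup>-\<^sup>\<beta> / 4\<close>, the buoyancy term is at
  most \<open>\<integral> \<theta>\<^sup>2 / 2\<close>, which the diffusion dominates by a Poincare inequality with constant \<open>1\<close>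
  (\<open>poincare_cell\<close>); the energy then decays at least like \<open>e\<^sup>-\<^sup>t\<close>.

  Every integration by parts above, and the Poincare inequality as well, is the statement that the
  divergence of a vector field integrates to \<open>0\<close> over the cell (\<open>integral_divergence_eq_0\<close>), for a
  field that is periodic in \<open>x\<close> and has no normal component on the walls. Each proof
  names its field and expands the divergence; what remains is a pointwise inequality.
\<close>

section \<open>Calculus on the periodicity cell\<close>

lemma cell_eq_cbox: "cell = cbox (0, 0) (1, 1)"
  unfolding cell_def by (simp add: cbox_Pair_eq)

lemma cell_subset_strip: "cell \<subseteq> strip"
  unfolding cell_def strip_def by auto

lemma integrable_cell:
  fixes f :: "real \<times> real \<Rightarrow> real"
  shows "continuous_on cell f \<Longrightarrow> f integrable_on cell"
  unfolding cell_eq_cbox by (rule integrable_continuous)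

lemma l2norm_power2: "(l2norm f)\<^sup>2 = integral cell (\<lambda>p. (norm (f p))\<^sup>2)"
proof -
  have "0 \<le> integral cell (\<lambda>p. (norm (f p))\<^sup>2)"
    by (cases "(\<lambda>p. (norm (f p))\<^sup>2) integrable_on cell")
      (auto intro: integral_nonneg simp: not_integrable_integral)
  then show ?thesis
    unfolding l2norm_def by simp
qed

lemma integral_square_nonneg:
  fixes f :: "real \<times> real \<Rightarrow> real"
  shows "0 \<le> integral cell (\<lambda>p. (f p)\<^sup>2)"
  using zero_le_power2[of "l2norm f"] unfolding l2norm_power2 by simp

lemma norm_Pair_power2:
  fixes a b :: real
  shows "(norm (a, b))\<^sup>2 = a\<^sup>2 + b\<^sup>2"
  by (simp add: norm_Pair)

text \<open>
  By Fubini, each summand can be integrated first in its own direction of differentiation, where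
  the fundamental theorem of calculus applies. The summands \<open>f\<close> and \<open>g\<close> are the diagonal
  derivatives only, so no mixed second derivatives enter when \<open>F\<close> and \<open>G\<close> contain gradients.
\<close>

lemma integral_divergence_eq_0:
  fixes F G f g :: "real \<times> real \<Rightarrow> real"
  assumes F: "\<And>x z. x \<in> {0..1} \<Longrightarrow> z \<in> {0..1} \<Longrightarrow>
      ((\<lambda>s. F (s, z)) has_real_derivative f (x, z)) (at x within {0..1})"
    and G: "\<And>x z. x \<in> {0..1} \<Longrightarrow> z \<in> {0..1} \<Longrightarrow>
      ((\<lambda>s. G (x, s)) has_real_derivative g (x, z)) (at z within {0..1})"
    and f: "continuous_on cell f" and g: "continuous_on cell g"
    and F01: "\<And>z. z \<in> {0..1} \<Longrightarrow> F (1, z) = F (0, z)"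
    and G01: "\<And>x. x \<in> {0..1} \<Longrightarrow> G (x, 1) = G (x, 0)"
  shows "integral cell (\<lambda>p. f p + g p) = 0"
proof -
  have f_x: "integral (cbox 0 1) (\<lambda>x. f (x, z)) = 0" if "z \<in> cbox 0 1" for z
    using fundamental_theorem_of_calculus[of 0 1 "\<lambda>s. F (s, z)" "\<lambda>x. f (x, z)"] F[of _ z] F01[of z] that
    by (simp add: has_real_derivative_iff_has_vector_derivative integral_unique)
  have g_z: "integral (cbox 0 1) (\<lambda>z. g (x, z)) = 0" if "x \<in> cbox 0 1" for x
    using fundamental_theorem_of_calculus[of 0 1 "\<lambda>s. G (x, s)" "\<lambda>z. g (x, z)"] G[of x] G01[of x] that
    by (simp add: has_real_derivative_iff_has_vector_derivative integral_unique)
  have "integral cell f = integral (cbox 0 1) (\<lambda>x. integral (cbox 0 1) (\<lambda>z. f (x, z)))"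
    using f integral_prod_continuous unfolding cell_eq_cbox by blast
  also have "\<dots> = integral (cbox 0 1) (\<lambda>z. integral (cbox 0 1) (\<lambda>x. f (x, z)))"
    using f by (intro integral_swap_continuous) (simp add: cell_eq_cbox split_beta)
  also have "\<dots> = integral (cbox 0 1) (\<lambda>_ :: real. 0)"
    by (rule Henstock_Kurzweil_Integration.integral_cong) (rule f_x)
  also have "\<dots> = 0"
    by simp
  finally have "integral cell f = 0" .
  moreover have "integral cell g = integral (cbox 0 1) (\<lambda>x. integral (cbox 0 1) (\<lambda>z. g (x, z)))"
    using g integral_prod_continuous unfolding cell_eq_cbox by blast
  moreover have "\<dots> = integral (cbox 0 1) (\<lambda>_ :: real. 0)"
    by (rule Henstock_Kurzweil_Integration.integral_cong) (rule g_z)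
  ultimately show ?thesis
    using f g by (simp add: integral_add integrable_cell)
qed

lemma C1_strip_deriv_x:
  assumes "C1_strip f" "z \<in> {0..1}"
  shows "((\<lambda>s. f (s, z)) has_real_derivative dx f (x, z)) (at x within S)"
proof -
  have "(\<lambda>s. f (s, z)) differentiable at x"
    using assms unfolding C1_strip_def strip_def by auto
  then show ?thesis
    unfolding dx_def
    by (simp add: DERIV_deriv_iff_real_differentiable[symmetric] has_field_derivative_at_within)
qed

lemma C1_strip_deriv_z:
  assumes "C1_strip f" "z \<in> {0..1}"
  shows "((\<lambda>s. f (x, s)) has_real_derivative dz f (x, z)) (at z within {0..1})"
proof -
  have "(\<lambda>s. f (x, s)) differentiable (at z within {0..1})"
    using assms unfolding C1_strip_def strip_def by auto
  then show ?thesis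
    unfolding dz_def has_real_derivative_iff_has_vector_derivative
    by (simp add: vector_derivative_works)
qed

lemma C1_strip_continuous_cell:
  assumes "C1_strip f"
  shows "continuous_on cell f" "continuous_on cell (dx f)" "continuous_on cell (dz f)"
  using assms cell_subset_strip unfolding C1_strip_def by (auto intro: continuous_on_subset)

lemma x_periodicD: "x_periodic f \<Longrightarrow> z \<in> {0..1} \<Longrightarrow> f (x + 1, z) = f (x, z)"
  unfolding x_periodic_def strip_def by auto

text \<open>The fluxes contain \<open>x\<close>-derivatives, which must match on \<open>x = 0\<close> and \<open>x = 1\<close>.\<close>

lemma x_periodic_dx:
  assumes "x_periodic f"
  shows "x_periodic (dx f)"
proof -
  have "dx f (x + 1, z) = dx f (x, z)" if "z \<in> {0..1}" for x z
  proof -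
    have "(DERIV (\<lambda>s. f (s, z)) (x + 1) :> D) \<longleftrightarrow> (DERIV (\<lambda>s. f (s, z)) x :> D)" for D
      using DERIV_shift[of "\<lambda>s. f (s, z)" D x 1] x_periodicD[OF assms that] by simp
    then show ?thesis
      unfolding dx_def deriv_def by simp
  qed
  then show ?thesis
    unfolding x_periodic_def strip_def by auto
qed

text \<open>
  The vertical field \<open>(z - 1/2) f\<^sup>2\<close> vanishes on the walls, so
  \<open>\<integral> f\<^sup>2 = - \<integral> 2 (z - 1/2) f f\<^sub>z \<le> \<integral> |f f\<^sub>z| \<le> \<integral> (f\<^sup>2 + f\<^sub>z\<^sup>2) / 2\<close>.
  Centring the weight at the middle of the layer makes \<open>|2 (z - 1/2)|\<close> at most \<open>1\<close>, which yields
  the constant \<open>1\<close>.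
\<close>

lemma poincare_cell:
  assumes f: "C1_strip f"
    and bdry: "\<And>x z. z \<in> {0, 1} \<Longrightarrow> f (x, z) = 0"
  shows "integral cell (\<lambda>p. (f p)\<^sup>2) \<le> integral cell (\<lambda>p. (dz f p)\<^sup>2)"
proof -
  note cont = C1_strip_continuous_cell[OF f]
  have "integral cell (\<lambda>p. 0 + ((f p)\<^sup>2 + 2 * (snd p - 1/2) * f p * dz f p)) = 0"
    by (rule integral_divergence_eq_0[where F = "\<lambda>_. 0"
          and G = "\<lambda>p. (snd p - 1/2) * (f p)\<^sup>2"])
      (auto intro!: derivative_eq_intros C1_strip_deriv_z[OF f] continuous_intros cont
        simp: bdry algebra_simps power2_eq_square)
  moreover have "integral cell (\<lambda>p. 1/2 * (f p)\<^sup>2 - 1/2 * (dz f p)\<^sup>2)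
      \<le> integral cell (\<lambda>p. 0 + ((f p)\<^sup>2 + 2 * (snd p - 1/2) * f p * dz f p))"
  proof (rule integral_le)
    fix p :: "real \<times> real" assume "p \<in> cell"
    then have "\<bar>2 * (snd p - 1/2)\<bar> \<le> 1"
      unfolding cell_def by (auto simp: abs_le_iff)
    then have "\<bar>2 * (snd p - 1/2)\<bar> * \<bar>f p * dz f p\<bar> \<le> 1 * \<bar>f p * dz f p\<bar>"
      by (intro mult_right_mono) auto
    then have "- (2 * (snd p - 1/2) * f p * dz f p) \<le> \<bar>f p * dz f p\<bar>"
      by (simp add: abs_mult[symmetric] mult.assoc)
    moreover have "\<bar>f p * dz f p\<bar> \<le> 1/2 * (f p)\<^sup>2 + 1/2 * (dz f p)\<^sup>2"
      using sum_squares_bound[of "\<bar>f p\<bar>" "\<bar>dz f p\<bar>"] by (simp add: abs_mult)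
    ultimately show "1/2 * (f p)\<^sup>2 - 1/2 * (dz f p)\<^sup>2
        \<le> 0 + ((f p)\<^sup>2 + 2 * (snd p - 1/2) * f p * dz f p)"
      by linarith
  qed (auto intro!: integrable_cell continuous_intros cont)
  moreover have "integral cell (\<lambda>p. 1/2 * (f p)\<^sup>2 - 1/2 * (dz f p)\<^sup>2)
      = 1/2 * integral cell (\<lambda>p. (f p)\<^sup>2) - 1/2 * integral cell (\<lambda>p. (dz f p)\<^sup>2)"
    by (subst integral_diff) (auto intro!: integrable_cell continuous_intros cont)
  ultimately show ?thesis
    by linarith
qed

section \<open>Estimates at a fixed time\<close>

definition velocity_const :: "real \<Rightarrow> real \<Rightarrow> real"
  where "velocity_const R \<beta> = 2 * R\<^sup>2 * ((exp \<beta>)\<^sup>2 + 1)"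

definition energy_const :: "real \<Rightarrow> real \<Rightarrow> real"
  where "energy_const R \<beta> = R / 2 * (1 + velocity_const R \<beta>) + velocity_const R \<beta> + (R * exp \<beta>)\<^sup>2"

lemma energy_const_pos: "0 < R \<Longrightarrow> 0 < energy_const R \<beta>"
  unfolding energy_const_def velocity_const_def
  by (intro add_pos_nonneg) (auto intro!: mult_pos_pos add_pos_nonneg)

text \<open>
  A solution at one fixed positive time; \<open>\<theta>'\<close> stands for the value of the time derivative of
  the temperature, so that the spatial estimates need no time variable.
\<close>

locale convection_slice =
  fixes R \<beta> :: real and \<theta> P \<theta>' :: "real \<times> real \<Rightarrow> real" and u :: "real \<times> real \<Rightarrow> real \<times> real"
  assumes \<beta>_nonneg: "0 \<le> \<beta>"
    and \<theta>_C2: "C2_strip \<theta>" and P_C2: "C2_strip P" and \<theta>'_cont: "continuous_on strip \<theta>'"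
    and \<theta>_periodic: "x_periodic \<theta>" and P_periodic: "x_periodic P"
    and bdry: "\<And>x z. z \<in> {0, 1} \<Longrightarrow> snd (u (x, z)) = 0 \<and> \<theta> (x, z) = 0 \<and> dz P (x, z) = 0"
    and pressure: "\<And>x z. z \<in> {0..1} \<Longrightarrow>
      laplacian P (x, z) - \<beta> * dz P (x, z) = R * exp (\<beta> * z) * dz \<theta> (x, z)"
    and darcy: "\<And>x z. z \<in> {0..1} \<Longrightarrow>
      u (x, z) = - exp (- \<beta> * z) *\<^sub>R grad P (x, z) + (R * \<theta> (x, z)) *\<^sub>R (0, 1)"
    and heat: "\<And>x z. z \<in> {0..1} \<Longrightarrow>
      \<theta>' (x, z) + u (x, z) \<bullet> grad \<theta> (x, z) = snd (u (x, z)) + laplacian \<theta> (x, z)"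
begin

lemma \<theta>_C1: "C1_strip \<theta>" "C1_strip (dx \<theta>)" "C1_strip (dz \<theta>)"
  and P_C1: "C1_strip P" "C1_strip (dx P)" "C1_strip (dz P)"
  using \<theta>_C2 P_C2 unfolding C2_strip_def by auto

lemmas deriv_rules =
  \<theta>_C1[THEN C1_strip_deriv_x] \<theta>_C1[THEN C1_strip_deriv_z]
  P_C1[THEN C1_strip_deriv_x] P_C1[THEN C1_strip_deriv_z]

lemmas cont_rules =
  \<theta>_C1[THEN C1_strip_continuous_cell(1)] \<theta>_C1[THEN C1_strip_continuous_cell(2)]
  \<theta>_C1[THEN C1_strip_continuous_cell(3)] P_C1[THEN C1_strip_continuous_cell(1)]
  P_C1[THEN C1_strip_continuous_cell(2)] P_C1[THEN C1_strip_continuous_cell(3)]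
  continuous_on_subset[OF \<theta>'_cont cell_subset_strip]

lemma wrap:
  assumes "z \<in> {0..1}"
  shows "\<theta> (1, z) = \<theta> (0, z)" "dx \<theta> (1, z) = dx \<theta> (0, z)"
    "P (1, z) = P (0, z)" "dx P (1, z) = dx P (0, z)"
  using assms x_periodicD[OF \<theta>_periodic, of z 0] x_periodicD[OF P_periodic, of z 0]
    x_periodicD[OF x_periodic_dx[OF \<theta>_periodic], of z 0]
    x_periodicD[OF x_periodic_dx[OF P_periodic], of z 0] by auto

lemma u_components:
  assumes "z \<in> {0..1}"
  shows "fst (u (x, z)) = - exp (- \<beta> * z) * dx P (x, z)"
    "snd (u (x, z)) = - exp (- \<beta> * z) * dz P (x, z) + R * \<theta> (x, z)"
  using darcy[OF assms] by (auto simp: grad_def)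

lemma u_cont: "continuous_on cell (\<lambda>p. fst (u p))" "continuous_on cell (\<lambda>p. snd (u p))"
proof -
  have "continuous_on cell (\<lambda>p. - exp (- \<beta> * snd p) * dx P p)"
    by (intro continuous_intros cont_rules)
  then show "continuous_on cell (\<lambda>p. fst (u p))"
    by (rule continuous_on_eq) (auto simp: cell_def u_components)
  have "continuous_on cell (\<lambda>p. - exp (- \<beta> * snd p) * dz P p + R * \<theta> p)"
    by (intro continuous_intros cont_rules)
  then show "continuous_on cell (\<lambda>p. snd (u p))"
    by (rule continuous_on_eq) (auto simp: cell_def u_components)
qed

lemma u_square_cont: "continuous_on cell (\<lambda>p. (norm (u p))\<^sup>2)"
proof -
  have "continuous_on cell (\<lambda>p. (fst (u p))\<^sup>2 + (snd (u p))\<^sup>2)"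
    by (intro continuous_intros u_cont)
  then show ?thesis
    by (simp add: norm_prod_def)
qed

text \<open>
  The field is \<open>e\<^sup>-\<^sup>\<beta>\<^sup>z P \<nabla>P - R P \<theta> k\<close>, with divergence \<open>e\<^sup>-\<^sup>\<beta>\<^sup>z |\<nabla>P|\<^sup>2 - R \<theta> P\<^sub>z\<close> by the pressure
  equation; on the walls its vertical component vanishes because \<open>P\<^sub>z = \<theta> = 0\<close> there. Weighting
  Young's inequality by \<open>e\<^sup>-\<^sup>\<beta>\<close> lets half of the pressure term absorb \<open>R \<theta> P\<^sub>z\<close>.
\<close>

lemma pressure_bound:
  "integral cell (\<lambda>p. (norm (grad P p))\<^sup>2) \<le> (R * exp \<beta>)\<^sup>2 * integral cell (\<lambda>p. (\<theta> p)\<^sup>2)"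
proof -
  define f where "f = (\<lambda>p. exp (- \<beta> * snd p) * ((dx P p)\<^sup>2 + P p * dx (dx P) p))"
  define g where "g = (\<lambda>p. exp (- \<beta> * snd p) * ((dz P p)\<^sup>2 + P p * dz (dz P) p
      - \<beta> * P p * dz P p) - R * (dz P p * \<theta> p + P p * dz \<theta> p))"
  have flux: "integral cell (\<lambda>p. f p + g p) = 0"
    unfolding f_def g_def
    by (rule integral_divergence_eq_0[where F = "\<lambda>p. exp (- \<beta> * snd p) * (P p * dx P p)"
          and G = "\<lambda>p. exp (- \<beta> * snd p) * (P p * dz P p) - R * (P p * \<theta> p)"])
      (auto intro!: derivative_eq_intros deriv_rules continuous_intros cont_rules
        simp: bdry wrap algebra_simps power2_eq_square)
  have "integral cell (\<lambda>p. 1/2 * exp (- \<beta>) * (norm (grad P p))\<^sup>2 - 1/2 * exp \<beta> * R\<^sup>2 * (\<theta> p)\<^sup>2)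
      \<le> integral cell (\<lambda>p. f p + g p)"
  proof (rule integral_le)
    fix p :: "real \<times> real" assume p: "p \<in> cell"
    obtain x z where xz: "p = (x, z)" "z \<in> {0..1}"
      using p by (auto simp: cell_def)
    have "exp (- \<beta> * z) * (dx (dx P) p + dz (dz P) p - \<beta> * dz P p) = R * dz \<theta> p"
      using pressure[of z x] xz by (simp add: laplacian_def exp_minus field_simps)
    then have "P p * (exp (- \<beta> * z) * (dx (dx P) p + dz (dz P) p - \<beta> * dz P p)) = P p * (R * dz \<theta> p)"
      by simp
    then have "f p + g p = exp (- \<beta> * z) * ((dx P p)\<^sup>2 + (dz P p)\<^sup>2) - R * (dz P p * \<theta> p)"
      unfolding f_def g_def xz by (simp add: algebra_simps)
    moreover have "exp (- \<beta>) * ((dx P p)\<^sup>2 + (dz P p)\<^sup>2) \<le> exp (- \<beta> * z) * ((dx P p)\<^sup>2 + (dz P p)\<^sup>2)"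
      using xz \<beta>_nonneg mult_left_le[of z \<beta>] by (intro mult_right_mono) auto
    moreover have "R * (dz P p * \<theta> p) \<le> 1/2 * exp (- \<beta>) * (dz P p)\<^sup>2 + 1/2 * exp \<beta> * R\<^sup>2 * (\<theta> p)\<^sup>2"
    proof -
      have "0 \<le> exp \<beta> * (exp (- \<beta>) * dz P p - R * \<theta> p)\<^sup>2"
        by simp
      also have "\<dots> = exp (- \<beta>) * (dz P p)\<^sup>2 + exp \<beta> * R\<^sup>2 * (\<theta> p)\<^sup>2 - 2 * (R * (dz P p * \<theta> p))"
        by (simp add: power2_eq_square exp_minus field_simps)
      finally show ?thesis by simp
    qed
    moreover have "0 \<le> exp (- \<beta>) * (dx P p)\<^sup>2"
      by simp
    ultimately show "1/2 * exp (- \<beta>) * (norm (grad P p))\<^sup>2 - 1/2 * exp \<beta> * R\<^sup>2 * (\<theta> p)\<^sup>2 \<le> f p + g p"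
      unfolding grad_def norm_Pair_power2 distrib_left by linarith
  qed (auto intro!: integrable_cell continuous_intros cont_rules simp: f_def g_def grad_def)
  also note flux
  finally have "1/2 * exp (- \<beta>) * integral cell (\<lambda>p. (norm (grad P p))\<^sup>2)
      \<le> 1/2 * exp \<beta> * R\<^sup>2 * integral cell (\<lambda>p. (\<theta> p)\<^sup>2)"
    by (subst (asm) integral_diff)
      (auto intro!: integrable_cell continuous_intros cont_rules simp: grad_def)
  then show ?thesis
    by (simp add: exp_minus field_simps power2_eq_square)
qed

text \<open>
  Darcy's law with weight \<open>e\<^sup>-\<^sup>\<beta>\<^sup>z \<le> 1\<close> gives \<open>|u|\<^sup>2 \<le> 2 |\<nabla>P|\<^sup>2 + 2 R\<^sup>2 \<theta>\<^sup>2\<close> pointwise; the first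
  term is controlled by \<open>pressure_bound\<close>.
\<close>

lemma velocity_bound:
  "integral cell (\<lambda>p. (norm (u p))\<^sup>2)
    \<le> velocity_const R \<beta> * integral cell (\<lambda>p. (\<theta> p)\<^sup>2)"
proof -
  have "integral cell (\<lambda>p. (norm (u p))\<^sup>2)
      \<le> integral cell (\<lambda>p. 2 * (norm (grad P p))\<^sup>2 + 2 * R\<^sup>2 * (\<theta> p)\<^sup>2)"
  proof (rule integral_le)
    fix p :: "real \<times> real" assume "p \<in> cell"
    then obtain x z where xz: "p = (x, z)" "z \<in> {0..1}"
      by (auto simp: cell_def)
    have e: "\<bar>- exp (- \<beta> * z)\<bar> \<le> 1"
      using xz \<beta>_nonneg by simp
    have "norm (u p) \<le> norm (- exp (- \<beta> * z) *\<^sub>R grad P p) + norm ((R * \<theta> p) *\<^sub>R (0::real, 1::real))"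
      using darcy[OF xz(2), of x] xz by (metis norm_triangle_ineq)
    also have "\<dots> \<le> norm (grad P p) + \<bar>R * \<theta> p\<bar>"
      using mult_right_mono[OF e norm_ge_zero[of "grad P p"]] by (simp add: norm_Pair)
    finally have "(norm (u p))\<^sup>2 \<le> (norm (grad P p) + \<bar>R * \<theta> p\<bar>)\<^sup>2"
      by (intro power_mono) auto
    also have "\<dots> \<le> 2 * (norm (grad P p))\<^sup>2 + 2 * (R * \<theta> p)\<^sup>2"
      using sum_squares_bound[of "norm (grad P p)" "\<bar>R * \<theta> p\<bar>"] by (simp add: power2_sum)
    finally show "(norm (u p))\<^sup>2 \<le> 2 * (norm (grad P p))\<^sup>2 + 2 * R\<^sup>2 * (\<theta> p)\<^sup>2"
      by (simp add: power_mult_distrib)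
  qed (auto intro!: integrable_cell u_square_cont continuous_intros cont_rules simp: grad_def)
  also have "\<dots> = 2 * integral cell (\<lambda>p. (norm (grad P p))\<^sup>2) + 2 * R\<^sup>2 * integral cell (\<lambda>p. (\<theta> p)\<^sup>2)"
    by (subst integral_add) (auto intro!: integrable_cell continuous_intros cont_rules simp: grad_def)
  finally show ?thesis
    using pressure_bound by (simp add: velocity_const_def algebra_simps power_mult_distrib)
qed

text \<open>
  The field is \<open>\<theta> \<nabla>\<theta> - \<theta>\<^sup>2 u / 2\<close>, which vanishes on the walls together with \<open>\<theta>\<close>. As \<open>u\<close> is
  divergence free, its divergence is \<open>|\<nabla>\<theta>|\<^sup>2 + \<theta> (\<Delta>\<theta> - u \<cdot> \<nabla>\<theta>)\<close>, and the heat equation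
  turns the bracket into \<open>\<theta>\<^sub>t - w\<close>.
\<close>

lemma energy_balance:
  "integral cell (\<lambda>p. \<theta> p * \<theta>' p)
    = integral cell (\<lambda>p. \<theta> p * snd (u p)) - integral cell (\<lambda>p. (norm (grad \<theta> p))\<^sup>2)"
proof -
  \<comment> \<open>Darcy's law determines \<open>u\<close> only on the strip. The explicit fields \<open>v\<close>, \<open>w\<close> agree with its
    components there; \<open>v'\<close> is the \<open>x\<close>-derivative of \<open>v\<close> and \<open>w'\<close> the \<open>z\<close>-derivative of \<open>w\<close>.\<close>
  define v where "v = (\<lambda>p. - exp (- \<beta> * snd p) * dx P p)"
  define w where "w = (\<lambda>p. - exp (- \<beta> * snd p) * dz P p + R * \<theta> p)"
  define v' where "v' = (\<lambda>p. - exp (- \<beta> * snd p) * dx (dx P) p)"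
  define w' where "w' = (\<lambda>p. exp (- \<beta> * snd p) * (\<beta> * dz P p - dz (dz P) p) + R * dz \<theta> p)"
  define f where "f = (\<lambda>p. (dx \<theta> p)\<^sup>2 + \<theta> p * dx (dx \<theta>) p
      - (\<theta> p * dx \<theta> p * v p + 1/2 * (\<theta> p)\<^sup>2 * v' p))"
  define g where "g = (\<lambda>p. (dz \<theta> p)\<^sup>2 + \<theta> p * dz (dz \<theta>) p
      - (\<theta> p * dz \<theta> p * w p + 1/2 * (\<theta> p)\<^sup>2 * w' p))"
  have "integral cell (\<lambda>p. f p + g p) = 0"
    unfolding f_def g_def v_def w_def v'_def w'_def
    by (rule integral_divergence_eq_0[where F = "\<lambda>p. \<theta> p * dx \<theta> p
            - 1/2 * (\<theta> p)\<^sup>2 * (- exp (- \<beta> * snd p) * dx P p)"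
          and G = "\<lambda>p. \<theta> p * dz \<theta> p
            - 1/2 * (\<theta> p)\<^sup>2 * (- exp (- \<beta> * snd p) * dz P p + R * \<theta> p)"])
      (auto intro!: derivative_eq_intros deriv_rules continuous_intros cont_rules
        simp: bdry wrap field_simps power2_eq_square)
  also have "integral cell (\<lambda>p. f p + g p)
      = integral cell (\<lambda>p. (norm (grad \<theta> p))\<^sup>2 + \<theta> p * \<theta>' p - \<theta> p * snd (u p))"
  proof (rule Henstock_Kurzweil_Integration.integral_cong)
    fix p :: "real \<times> real" assume "p \<in> cell"
    then obtain x z where xz: "p = (x, z)" "z \<in> {0..1}"
      by (auto simp: cell_def)
    have u: "u p = (v p, w p)"
      using u_components[OF xz(2), of x] by (simp add: xz(1) prod_eq_iff v_def w_def)
    have "exp (- \<beta> * z) * (dx (dx P) p + dz (dz P) p - \<beta> * dz P p) = R * dz \<theta> p"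
      using pressure[of z x] xz by (simp add: laplacian_def exp_minus field_simps)
    \<comment> \<open>the pressure equation says exactly that \<open>u\<close> is divergence free\<close>
    then have div: "w' p = - v' p"
      unfolding v'_def w'_def xz by (simp add: algebra_simps)
    have heat': "dx (dx \<theta>) p + dz (dz \<theta>) p = \<theta>' p + v p * dx \<theta> p + w p * dz \<theta> p - w p"
      using heat[OF xz(2), of x] u xz by (simp add: laplacian_def grad_def)
    have "f p + g p = (dx \<theta> p)\<^sup>2 + (dz \<theta> p)\<^sup>2 + \<theta> p * (dx (dx \<theta>) p + dz (dz \<theta>) p)
        - \<theta> p * (v p * dx \<theta> p + w p * dz \<theta> p)"
      unfolding f_def g_def div by (simp add: algebra_simps)
    then show "f p + g p = (norm (grad \<theta> p))\<^sup>2 + \<theta> p * \<theta>' p - \<theta> p * snd (u p)"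
      unfolding heat' u grad_def norm_Pair_power2 by (simp add: algebra_simps)
  qed
  also have "\<dots> = integral cell (\<lambda>p. (norm (grad \<theta> p))\<^sup>2) + integral cell (\<lambda>p. \<theta> p * \<theta>' p)
      - integral cell (\<lambda>p. \<theta> p * snd (u p))"
  proof -
    have "(\<lambda>p. (norm (grad \<theta> p))\<^sup>2) integrable_on cell" "(\<lambda>p. \<theta> p * \<theta>' p) integrable_on cell"
      "(\<lambda>p. \<theta> p * snd (u p)) integrable_on cell"
      unfolding grad_def by (intro integrable_cell continuous_intros cont_rules u_cont)+
    then show ?thesis
      by (simp add: integral_diff integral_add integrable_add)
  qed
  finally show ?thesis
    by simp
qed

text \<open>
  Young's inequality with a free weight: \<open>a = 1/2\<close> serves the a priori estimate, while decay needs
  a smaller share of \<open>\<integral> \<theta>\<^sup>2\<close> and can afford a larger multiple of the velocity, which is of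
  order \<open>R\<^sup>2\<close>.
\<close>

lemma buoyancy_bound:
  assumes "0 < a"
  shows "integral cell (\<lambda>p. \<theta> p * snd (u p))
    \<le> a * integral cell (\<lambda>p. (\<theta> p)\<^sup>2) + 1 / (4 * a) * integral cell (\<lambda>p. (norm (u p))\<^sup>2)"
proof -
  have "integral cell (\<lambda>p. \<theta> p * snd (u p))
      \<le> integral cell (\<lambda>p. a * (\<theta> p)\<^sup>2 + 1 / (4 * a) * (norm (u p))\<^sup>2)"
  proof (rule integral_le)
    fix p
    have "0 \<le> a * (\<theta> p - snd (u p) / (2 * a))\<^sup>2"
      using assms by simp
    also have "\<dots> = a * (\<theta> p)\<^sup>2 + 1 / (4 * a) * (snd (u p))\<^sup>2 - \<theta> p * snd (u p)"
      using assms by (simp add: power2_eq_square field_simps)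
    finally have "\<theta> p * snd (u p) \<le> a * (\<theta> p)\<^sup>2 + 1 / (4 * a) * (snd (u p))\<^sup>2"
      by simp
    also have "\<dots> \<le> a * (\<theta> p)\<^sup>2 + 1 / (4 * a) * (norm (u p))\<^sup>2"
      using assms by (simp add: norm_prod_def divide_right_mono)
    finally show "\<theta> p * snd (u p) \<le> a * (\<theta> p)\<^sup>2 + 1 / (4 * a) * (norm (u p))\<^sup>2" .
  qed (intro integrable_cell u_square_cont u_cont continuous_intros cont_rules)+
  also have "\<dots> = a * integral cell (\<lambda>p. (\<theta> p)\<^sup>2)
      + 1 / (4 * a) * integral cell (\<lambda>p. (norm (u p))\<^sup>2)"
  proof -
    have "(\<lambda>p. a * (\<theta> p)\<^sup>2) integrable_on cell"
      "(\<lambda>p. 1 / (4 * a) * (norm (u p))\<^sup>2) integrable_on cell"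
      by (intro integrable_cell u_square_cont continuous_intros cont_rules)+
    then show ?thesis
      by (simp add: integral_add del: times_divide_eq_left)
  qed
  finally show ?thesis .
qed

end

section \<open>Evolution in time\<close>

text \<open>
  The differential inequality is assumed only in the open interval, since the solution is merely
  continuous at the initial time: \<open>f(s) e\<^sup>-\<^sup>k\<^sup>s\<close> is continuous and has nonpositive
  derivative inside.
\<close>

lemma gronwall_open:
  fixes f :: "real \<Rightarrow> real"
  assumes "0 \<le> t" and cont: "continuous_on {0..t} f"
    and growth: "\<And>s. 0 < s \<Longrightarrow> s < t \<Longrightarrow> \<exists>D. (f has_real_derivative D) (at s) \<and> D \<le> k * f s"
  shows "f t \<le> f 0 * exp (k * t)"
proof -
  have "f t * exp (- k * t) \<le> f 0 * exp (- k * 0)"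
  proof (rule DERIV_nonpos_imp_decreasing_open[OF \<open>0 \<le> t\<close>])
    fix s assume "0 < s" "s < t"
    then obtain D where D: "(f has_real_derivative D) (at s)" "D \<le> k * f s"
      using growth by blast
    have "((\<lambda>s. f s * exp (- k * s)) has_real_derivative (D - k * f s) * exp (- k * s)) (at s)"
      using D by (auto intro!: derivative_eq_intros simp: algebra_simps)
    moreover have "(D - k * f s) * exp (- k * s) \<le> 0"
      using D by (simp add: mult_nonpos_nonneg)
    ultimately show "\<exists>y. ((\<lambda>s. f s * exp (- k * s)) has_real_derivative y) (at s) \<and> y \<le> 0"
      by blast
  qed (intro continuous_intros cont)
  then show ?thesis
    by (simp add: exp_minus field_simps)
qed

locale convection_solution =
  fixes R \<beta> :: real and T :: ereal and \<theta> P :: "real \<Rightarrow> real \<times> real \<Rightarrow> real"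
    and u :: "real \<Rightarrow> real \<times> real \<Rightarrow> real \<times> real"
  assumes \<beta>_nonneg: "0 \<le> \<beta>" and R_pos: "0 < R"
    and solution: "is_solution R \<beta> T \<theta> u P"
begin

abbreviation "theta_sq t \<equiv> integral cell (\<lambda>p. (\<theta> t p)\<^sup>2)"

lemma slice:
  assumes "0 < t" "ereal t < T"
  shows "convection_slice R \<beta> (\<theta> t) (P t) (\<lambda>p. deriv (\<lambda>s. \<theta> s p) t) (u t)"
proof
  have "continuous_on ({t. 0 < t \<and> ereal t < T} \<times> strip) (\<lambda>(t, p). deriv (\<lambda>s. \<theta> s p) t)"
    using solution unfolding is_solution_def by blast
  then have "continuous_on strip ((\<lambda>(t, p). deriv (\<lambda>s. \<theta> s p) t) \<circ> (\<lambda>p. (t, p)))"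
    using assms by (intro continuous_on_compose) (auto intro!: continuous_intros elim!: continuous_on_subset)
  then show "continuous_on strip (\<lambda>p. deriv (\<lambda>s. \<theta> s p) t)"
    by (simp add: o_def)
next
  fix x z :: real assume "z \<in> {0, 1}"
  then show "snd (u t (x, z)) = 0 \<and> \<theta> t (x, z) = 0 \<and> dz (P t) (x, z) = 0"
    using solution assms unfolding is_solution_def by blast
next
  fix x z :: real assume "z \<in> {0..1}"
  then have "(x, z) \<in> strip"
    by (simp add: strip_def)
  then show "laplacian (P t) (x, z) - \<beta> * dz (P t) (x, z) = R * exp (\<beta> * z) * dz (\<theta> t) (x, z)"
    and "u t (x, z) = - exp (- \<beta> * z) *\<^sub>R grad (P t) (x, z) + (R * \<theta> t (x, z)) *\<^sub>R (0, 1)"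
    and "deriv (\<lambda>s. \<theta> s (x, z)) t + u t (x, z) \<bullet> grad (\<theta> t) (x, z)
      = snd (u t (x, z)) + laplacian (\<theta> t) (x, z)"
    using solution assms unfolding is_solution_def by blast+
qed (use solution assms \<beta>_nonneg in \<open>simp_all add: is_solution_def\<close>)

lemma theta_sq_continuous: "continuous_on {t. 0 \<le> t \<and> ereal t < T} theta_sq"
proof -
  have "continuous_on ({t. 0 \<le> t \<and> ereal t < T} \<times> strip) (\<lambda>(t, p). \<theta> t p)"
    using solution unfolding is_solution_def by blast
  then have "continuous_on ({t. 0 \<le> t \<and> ereal t < T} \<times> cell) (\<lambda>(t, p). \<theta> t p)"
    by (rule continuous_on_subset) (use cell_subset_strip in auto)
  then have "continuous_on ({t. 0 \<le> t \<and> ereal t < T} \<times> cell) (\<lambda>(t, p). (\<theta> t p)\<^sup>2)"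
    by (auto simp: split_beta intro: continuous_on_power)
  then show ?thesis
    unfolding cell_eq_cbox by (rule integral_continuous_on_param)
qed

text \<open>
  Differentiation under the integral sign. The set of positive times before \<open>T\<close> is open, so the
  derivative relative to it is the two-sided one.
\<close>

lemma theta_sq_deriv:
  assumes t: "0 < t" "ereal t < T"
  shows "(theta_sq has_real_derivative 2 * integral cell (\<lambda>p. \<theta> t p * deriv (\<lambda>s. \<theta> s p) t)) (at t)"
proof -
  let ?U = "{t. 0 < t \<and> ereal t < T}"
  have "?U = {0<..} \<inter> ereal -` {..<T}"
    by auto
  then have "open ?U"
    by (simp add: open_ereal_vimage open_Int)
  have "convex ?U"
    unfolding is_interval_convex_1[symmetric] is_interval_1
    by (auto intro: le_less_trans[of "ereal _" "ereal _"])
  have \<theta>_cont: "continuous_on (?U \<times> strip) (\<lambda>(t, p). \<theta> t p)"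
    by (rule continuous_on_subset[of "{t. 0 \<le> t \<and> ereal t < T} \<times> strip"])
      (use solution in \<open>auto simp: is_solution_def\<close>)
  moreover have "continuous_on (?U \<times> strip) (\<lambda>(t, p). deriv (\<lambda>s. \<theta> s p) t)"
    using solution unfolding is_solution_def by blast
  ultimately have "continuous_on (?U \<times> strip) (\<lambda>(t, p). 2 * \<theta> t p * deriv (\<lambda>s. \<theta> s p) t)"
    by (auto simp: split_beta intro!: continuous_intros)
  then have cont: "continuous_on (?U \<times> cell) (\<lambda>(t, p). 2 * \<theta> t p * deriv (\<lambda>s. \<theta> s p) t)"
    by (rule continuous_on_subset) (use cell_subset_strip in auto)
  have "(theta_sq has_real_derivative
      integral cell (\<lambda>p. 2 * \<theta> t p * deriv (\<lambda>s. \<theta> s p) t)) (at t within ?U)"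
    unfolding cell_eq_cbox
  proof (rule leibniz_rule_field_derivative[where U = ?U])
    fix s p assume "s \<in> ?U" and "p \<in> cbox (0 :: real, 0 :: real) (1, 1)"
    then have "0 < s" "ereal s < T" "p \<in> strip"
      using subsetD[OF cell_subset_strip] by (simp_all add: cell_eq_cbox)
    moreover have "\<forall>t p. 0 < t \<longrightarrow> ereal t < T \<longrightarrow> p \<in> strip \<longrightarrow> (\<lambda>s. \<theta> s p) differentiable at t"
      using solution unfolding is_solution_def by (elim conjE)
    ultimately have "(\<lambda>s. \<theta> s p) differentiable at s"
      by blast
    then have "((\<lambda>s. \<theta> s p) has_real_derivative deriv (\<lambda>s. \<theta> s p) s) (at s within ?U)"
      by (simp add: DERIV_deriv_iff_real_differentiable has_field_derivative_at_within)
    then show "((\<lambda>s. (\<theta> s p)\<^sup>2) has_real_derivative 2 * \<theta> s p * deriv (\<lambda>s. \<theta> s p) s) (at s within ?U)"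
      by (auto intro!: derivative_eq_intros)
  next
    fix s assume "s \<in> ?U"
    then interpret convection_slice R \<beta> "\<theta> s" "P s" "\<lambda>p. deriv (\<lambda>s. \<theta> s p) s" "u s"
      by (auto intro: slice)
    show "(\<lambda>p. (\<theta> s p)\<^sup>2) integrable_on cbox (0, 0) (1, 1)"
      unfolding cell_eq_cbox[symmetric] by (intro integrable_cell continuous_intros cont_rules)
  qed (use cont t \<open>convex ?U\<close> in \<open>auto simp: cell_eq_cbox\<close>)
  then show ?thesis
    using t \<open>open ?U\<close> at_within_open[of t ?U] by (simp add: mult.assoc)
qed

lemma energy_le_exp:
  assumes "0 \<le> t" "ereal t < T"
    and "\<And>s. 0 < s \<Longrightarrow> ereal s < T \<Longrightarrow>
      deriv theta_sq s \<le> k * theta_sq s"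
  shows "energy R \<theta> t \<le> energy R \<theta> 0 * exp (k * t)"
proof -
  have before_T: "ereal s < T" if "s \<le> t" for s
    using that assms(2) by (simp add: le_less_trans[of "ereal s" "ereal t"])
  have "theta_sq t \<le> theta_sq 0 * exp (k * t)"
  proof (rule gronwall_open)
    show "continuous_on {0..t} theta_sq"
      by (rule continuous_on_subset[OF theta_sq_continuous]) (use before_T in auto)
    fix s assume s: "0 < s" "s < t"
    show "\<exists>D. (theta_sq has_real_derivative D) (at s) \<and> D \<le> k * theta_sq s"
      using theta_sq_deriv[of s] assms(3)[of s] before_T[of s] s by (auto simp: DERIV_imp_deriv)
  qed (fact assms)
  then show ?thesis
    using R_pos by (simp add: energy_def l2norm_power2 mult_left_mono)
qed

text \<open>
  With \<open>K\<close> the velocity constant, \<open>\<integral> \<theta> w \<le> (1 + K) / 2 \<integral> \<theta>\<^sup>2\<close>; the remaining two summands of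
  \<open>energy_const\<close> pay for the norms of \<open>u\<close> and \<open>\<nabla>P\<close> on the left-hand side.
\<close>

lemma energy_inequality:
  assumes t: "0 < t" "ereal t < T"
  shows "R / 2 * deriv theta_sq t + R * (l2norm (grad (\<theta> t)))\<^sup>2
      + (l2norm (u t))\<^sup>2 + (l2norm (grad (P t)))\<^sup>2 \<le> energy_const R \<beta> * theta_sq t"
proof -
  interpret convection_slice R \<beta> "\<theta> t" "P t" "\<lambda>p. deriv (\<lambda>s. \<theta> s p) t" "u t"
    by (rule slice[OF t])
  let ?K = "velocity_const R \<beta>"
  have "integral cell (\<lambda>p. \<theta> t p * snd (u t p)) \<le> 1/2 * theta_sq t + 1/2 * (l2norm (u t))\<^sup>2"
    using buoyancy_bound[of "1/2"] by (simp add: l2norm_power2)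
  moreover have v: "(l2norm (u t))\<^sup>2 \<le> ?K * theta_sq t"
    using velocity_bound by (simp add: l2norm_power2)
  ultimately have "integral cell (\<lambda>p. \<theta> t p * snd (u t p)) \<le> (1 + ?K) / 2 * theta_sq t"
    by (simp add: field_simps)
  then have "R * integral cell (\<lambda>p. \<theta> t p * snd (u t p)) \<le> R * ((1 + ?K) / 2 * theta_sq t)"
    using R_pos by (intro mult_left_mono) auto
  moreover have "R / 2 * deriv theta_sq t + R * (l2norm (grad (\<theta> t)))\<^sup>2
      = R * integral cell (\<lambda>p. \<theta> t p * snd (u t p))"
    unfolding DERIV_imp_deriv[OF theta_sq_deriv[OF t]] energy_balance l2norm_power2
    by (simp add: algebra_simps)
  moreover have "(l2norm (grad (P t)))\<^sup>2 \<le> (R * exp \<beta>)\<^sup>2 * theta_sq t"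
    using pressure_bound by (simp add: l2norm_power2)
  moreover have "energy_const R \<beta> * theta_sq t
      = R * ((1 + ?K) / 2 * theta_sq t) + ?K * theta_sq t + (R * exp \<beta>)\<^sup>2 * theta_sq t"
    unfolding energy_const_def by (simp add: algebra_simps)
  ultimately show ?thesis
    using v by linarith
qed

lemma energy_growth:
  assumes t: "0 \<le> t" "ereal t < T" and k: "2 * energy_const R \<beta> / R \<le> k"
  shows "energy R \<theta> t \<le> energy R \<theta> 0 * exp (k * t)"
proof (rule energy_le_exp[OF t])
  fix s assume s: "0 < s" "ereal s < T"
  have "0 \<le> R * (l2norm (grad (\<theta> s)))\<^sup>2" "0 \<le> (l2norm (u s))\<^sup>2" "0 \<le> (l2norm (grad (P s)))\<^sup>2"
    using R_pos by auto
  then have "R / 2 * deriv theta_sq s \<le> energy_const R \<beta> * theta_sq s"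
    using energy_inequality[OF s] by linarith
  then have "deriv theta_sq s \<le> 2 * energy_const R \<beta> / R * theta_sq s"
    using R_pos by (simp add: field_simps)
  also have "\<dots> \<le> k * theta_sq s"
    using k integral_square_nonneg by (rule mult_right_mono)
  finally show "deriv theta_sq s \<le> k * theta_sq s" .
qed

text \<open>
  For such \<open>R\<close> the velocity constant is at most \<open>1/4\<close>, and \<open>buoyancy_bound\<close> with \<open>a = 1/4\<close> gives
  \<open>\<integral> \<theta> w \<le> (1/4 + 1/4) \<integral> \<theta>\<^sup>2\<close>. By the Poincare inequality this is at most half of the
  dissipation, so \<open>\<integral> \<theta> \<theta>\<^sub>t \<le> - 1/2 \<integral> \<theta>\<^sup>2\<close>.
\<close>

lemma theta_sq_decay:
  assumes t: "0 < t" "ereal t < T" and small: "R < exp (- \<beta>) / 4"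
  shows "deriv theta_sq t \<le> - 1 * theta_sq t"
proof -
  interpret convection_slice R \<beta> "\<theta> t" "P t" "\<lambda>p. deriv (\<lambda>s. \<theta> s p) t" "u t"
    by (rule slice[OF t])
  have "(R * exp \<beta>)\<^sup>2 \<le> (1/4)\<^sup>2"
    using small R_pos by (intro power_mono) (auto simp: exp_minus field_simps)
  moreover have "R\<^sup>2 \<le> (R * exp \<beta>)\<^sup>2"
    using R_pos \<beta>_nonneg by (intro power_mono) (auto simp: mult_le_cancel_left1)
  ultimately have "2 * R\<^sup>2 * ((exp \<beta>)\<^sup>2 + 1) \<le> 1/4"
    by (simp add: power_mult_distrib power2_eq_square algebra_simps)
  then have "velocity_const R \<beta> * theta_sq t \<le> 1/4 * theta_sq t"
    unfolding velocity_const_def using integral_square_nonneg by (rule mult_right_mono)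
  then have "integral cell (\<lambda>p. \<theta> t p * snd (u t p)) \<le> 1/2 * theta_sq t"
    using buoyancy_bound[of "1/4"] velocity_bound by simp
  moreover have "integral cell (\<lambda>p. (dz (\<theta> t) p)\<^sup>2) \<le> integral cell (\<lambda>p. (norm (grad (\<theta> t) p))\<^sup>2)"
    by (rule integral_le)
      (auto intro!: integrable_cell continuous_intros cont_rules simp: grad_def norm_Pair_power2)
  moreover have "theta_sq t \<le> integral cell (\<lambda>p. (dz (\<theta> t) p)\<^sup>2)"
    using bdry by (intro poincare_cell \<theta>_C1) auto
  ultimately show ?thesis
    using energy_balance DERIV_imp_deriv[OF theta_sq_deriv[OF t]] by linarith
qed

end

theorem proposition3p1:
  fixes \<beta> :: real
  assumes "\<beta> \<ge> 0"
  shows "(\<forall>R>0. \<exists>A<0. \<exists>B<0. \<exists>c\<^sub>0>0. \<forall>T \<theta> u P. T > 0 \<longrightarrow> is_solution R \<beta> T \<theta> u P \<longrightarrow>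
            (\<forall>t. 0 < t \<and> ereal t < T \<longrightarrow>
               (\<lambda>s. (l2norm (\<theta> s))\<^sup>2) differentiable at t \<and>
               R / 2 * deriv (\<lambda>s. (l2norm (\<theta> s))\<^sup>2) t + R * (l2norm (grad (\<theta> t)))\<^sup>2
                 - A * (l2norm (u t))\<^sup>2 - B * (l2norm (grad (P t)))\<^sup>2
               \<le> c\<^sub>0 * (l2norm (\<theta> t))\<^sup>2) \<and>
            (\<forall>t. 0 \<le> t \<and> ereal t < T \<longrightarrow> energy R \<theta> t \<le> energy R \<theta> 0 * exp (c\<^sub>0 * t))) \<and>
         (\<exists>R\<^sub>0>0. \<forall>R. 0 < R \<and> R < R\<^sub>0 \<longrightarrow> (\<exists>\<delta>>0. \<forall>T \<theta> u P. T > 0 \<longrightarrow> is_solution R \<beta> T \<theta> u P \<longrightarrow>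
            (\<forall>t. 0 \<le> t \<and> ereal t < T \<longrightarrow> energy R \<theta> t \<le> energy R \<theta> 0 * exp (- \<delta> * t))))"
    (is "(\<forall>R>0. \<exists>A<0. \<exists>B<0. \<exists>c>0. ?bounded R A B c) \<and> (\<exists>R\<^sub>0>0. \<forall>R. 0 < R \<and> R < R\<^sub>0 \<longrightarrow> ?decays R)")
proof
  show "\<forall>R>0. \<exists>A<0. \<exists>B<0. \<exists>c>0. ?bounded R A B c"
  proof (intro allI impI)
    fix R :: real assume R: "0 < R"
    \<comment> \<open>One constant serves both claims: the a priori estimate holds with \<open>energy_const\<close>, whereas the
      energy is \<open>R / 2\<close> times \<open>\<integral> \<theta>\<^sup>2\<close> and so grows at the rate \<open>2 / R\<close> times that constant.\<close>
    let ?c = "max (energy_const R \<beta>) (2 * energy_const R \<beta> / R)"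
    have "?bounded R (- 1) (- 1) ?c"
    proof (intro allI impI)
      fix T :: ereal and \<theta> u P
      assume "is_solution R \<beta> T \<theta> u P"
      then interpret convection_solution R \<beta> T \<theta> P u
        using assms R by unfold_locales
      have l2: "(\<lambda>s. (l2norm (\<theta> s))\<^sup>2) = theta_sq"
        by (simp add: l2norm_power2)
      have c: "energy_const R \<beta> * theta_sq t \<le> ?c * theta_sq t" for t
        using integral_square_nonneg by (intro mult_right_mono) auto
      have "(\<lambda>s. (l2norm (\<theta> s))\<^sup>2) differentiable at t \<and>
          R / 2 * deriv (\<lambda>s. (l2norm (\<theta> s))\<^sup>2) t + R * (l2norm (grad (\<theta> t)))\<^sup>2
            - (- 1) * (l2norm (u t))\<^sup>2 - (- 1) * (l2norm (grad (P t)))\<^sup>2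
          \<le> ?c * (l2norm (\<theta> t))\<^sup>2" if t: "0 < t \<and> ereal t < T" for t
      proof
        show "(\<lambda>s. (l2norm (\<theta> s))\<^sup>2) differentiable at t"
          unfolding l2 using theta_sq_deriv t real_differentiable_def by blast
        show "R / 2 * deriv (\<lambda>s. (l2norm (\<theta> s))\<^sup>2) t + R * (l2norm (grad (\<theta> t)))\<^sup>2
            - (- 1) * (l2norm (u t))\<^sup>2 - (- 1) * (l2norm (grad (P t)))\<^sup>2 \<le> ?c * (l2norm (\<theta> t))\<^sup>2"
          using energy_inequality[of t] t c[of t] unfolding l2 fun_cong[OF l2, of t] by linarith
      qed
      moreover have "energy R \<theta> t \<le> energy R \<theta> 0 * exp (?c * t)" if "0 \<le> t \<and> ereal t < T" for t
        using that by (intro energy_growth) auto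
      ultimately show "(\<forall>t. 0 < t \<and> ereal t < T \<longrightarrow>
            (\<lambda>s. (l2norm (\<theta> s))\<^sup>2) differentiable at t \<and>
            R / 2 * deriv (\<lambda>s. (l2norm (\<theta> s))\<^sup>2) t + R * (l2norm (grad (\<theta> t)))\<^sup>2
              - (- 1) * (l2norm (u t))\<^sup>2 - (- 1) * (l2norm (grad (P t)))\<^sup>2
            \<le> ?c * (l2norm (\<theta> t))\<^sup>2) \<and>
          (\<forall>t. 0 \<le> t \<and> ereal t < T \<longrightarrow> energy R \<theta> t \<le> energy R \<theta> 0 * exp (?c * t))"
        by blast
    qed
    moreover have "0 < ?c" "- 1 < (0 :: real)"
      using energy_const_pos[OF R] by (auto simp: less_max_iff_disj)
    ultimately show "\<exists>A<0. \<exists>B<0. \<exists>c>0. ?bounded R A B c"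
      by blast
  qed
next
  have "?decays R" if R: "0 < R \<and> R < exp (- \<beta>) / 4" for R
  proof -
    have "energy R \<theta> t \<le> energy R \<theta> 0 * exp (- 1 * t)"
      if "is_solution R \<beta> T \<theta> u P" and t: "0 \<le> t" "ereal t < T" for T \<theta> u P t
    proof -
      interpret convection_solution R \<beta> T \<theta> P u
        using assms R that by unfold_locales auto
      show ?thesis
        by (rule energy_le_exp[OF t]) (rule theta_sq_decay, use R in auto)
    qed
    then show ?thesis
      by (intro exI[of _ "1 :: real"]) simp
  qed
  then show "\<exists>R\<^sub>0>0. \<forall>R. 0 < R \<and> R < R\<^sub>0 \<longrightarrow> ?decays R"
    by (intro exI[of _ "exp (- \<beta>) / 4"]) simp
qed

end
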